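(* Let $\mathbf{k}$ be a commutative ring and $q\in\mathbf{k}$ such that $q+1$ is invertible in $\mathbf{k}$. Then the family $(\eta^{(q)}_{s,I})_{s\ge0,\,I\subseteq[s-1]}$ is a basis of the $\mathbf{k}$-module $\operatorname{QSym}$. Furthermore, for every $s\ge0$ and $J\subseteq[s-1]$, \[(q+1)^{s-|J|}M_J=\sum_{J\subseteq I\subseteq[s-1]}(-1)^{|I\setminus J|}\eta^{(q)}_I.\]
   Context: Let $x_1,x_2,\dots$ be commuting indeterminates. $\operatorname{QSym}$ is the subring of $\mathbf{k}[[x_1,x_2,\dots]]$ of quasisymmetric functions: bounded-degree power series such that for every strictly increasing $i_1<\cdots<i_p$ the coefficient of $x_{i_1}^{k_1}\cdots x_{i_p}^{k_p}$ equals that of $x_1^{k_1}\cdots x_p^{k_p}$. For $s\ge0$ and $I\subseteq[s-1]$ (with $[s-1]=\emptyset$ if $s\le1$), $M_J=M_{s,J}=\sum x_{i_1}\cdots x_{i_s}$ over $i_1\le\cdots\le i_s$ with $j\in J\iff i_j=i_{j+1}$ for all $j\in[s-1]$, and $\eta^{(q)}_I=\eta^{(q)}_{s,I}=\sum(q+1)^{|\{i_1,\dots,i_s\}|}x_{i_1}\cdots x_{i_s}$ over $i_1\le\cdots\le i_s$ with $j\in I\Rightarrow i_j=i_{j+1}$. *)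

theory Defs
  imports Complex_Main "HOL-Library.Multiset" "HOL-Library.Function_Algebras"
begin

text \<open>
  A monomial in the commuting indeterminates \<open>x\<^sub>1, x\<^sub>2, \<dots>\<close> is a finite multiset of variable
  indices, and a formal power series is its coefficient function. The natural number \<open>i\<close> stands
  for the indeterminate \<open>x\<^bsub>i+1\<^esub>\<close>. Addition of power series is the pointwise addition of
  \<^theory>\<open>HOL-Library.Function_Algebras\<close>; the pointwise multiplication provided there is not
  the multiplication of power series and is not used.
\<close>

type_synonym 'k power_series = "nat multiset \<Rightarrow> 'k"

definition ps_scale :: "'k::comm_ring_1 \<Rightarrow> 'k power_series \<Rightarrow> 'k power_series"  (infixr "*\<^sub>s" 75)
  where "c *\<^sub>s f = (\<lambda>m. c * f m)"

interpretation power_series: module ps_scale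
  by unfold_locales (auto simp: ps_scale_def fun_eq_iff algebra_simps)

definition bounded_degree :: "'k::zero power_series \<Rightarrow> bool" where
  "bounded_degree f \<longleftrightarrow> (\<exists>d. \<forall>m. f m \<noteq> 0 \<longrightarrow> size m \<le> d)"

definition QSym :: "'k::zero power_series set" where
  "QSym = {f. bounded_degree f \<and>
     (\<forall>p (i :: nat \<Rightarrow> nat) (k :: nat \<Rightarrow> nat). strict_mono_on {..<p} i \<longrightarrow>
        f (\<Sum>j<p. replicate_mset (k j) (i j)) = f (\<Sum>j<p. replicate_mset (k j) j))}"

text \<open>
  The two families are defined by reading off coefficients of the defining infinite sums. The tuple
  \<open>i\<^sub>1 \<le> \<dots> \<le> i\<^sub>s\<close> is a sorted list \<open>w\<close>, so that \<open>i\<^sub>j\<close> is \<open>w ! (j - 1)\<close>, and the sum over all such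
  lists with \<open>mset w = m\<close> is finite (there is at most one).
\<close>

definition monom_qsym :: "nat \<Rightarrow> nat set \<Rightarrow> 'k::comm_ring_1 power_series" where
  "monom_qsym s J = (\<lambda>m. \<Sum>w | length w = s \<and> sorted w \<and>
                       (\<forall>j\<in>{1..s-1}. j \<in> J \<longleftrightarrow> w ! (j - 1) = w ! j) \<and> mset w = m. 1)"

definition eta :: "'k::comm_ring_1 \<Rightarrow> nat \<Rightarrow> nat set \<Rightarrow> 'k power_series" where
  "eta q s I = (\<lambda>m. \<Sum>w | length w = s \<and> sorted w \<and>
                       (\<forall>j\<in>{1..s-1}. j \<in> I \<longrightarrow> w ! (j - 1) = w ! j) \<and> mset w = m.
                     (q + 1) ^ card (set w))"

definition is_basis_of ::
  "'i set \<Rightarrow> ('i \<Rightarrow> 'k::comm_ring_1 power_series) \<Rightarrow> 'k power_series set \<Rightarrow> bool" where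
  "is_basis_of A e V \<longleftrightarrow>
     inj_on e A \<and> power_series.independent (e ` A) \<and> power_series.span (e ` A) = V"

end

theory Submission
  imports Defs
begin

text \<open>
  The coefficients of a quasisymmetric function at a monomial depend only on the degree of the
  monomial and on the set of positions at which its sorted list of indices repeats a letter. Every
  subset of \<open>[s-1]\<close> arises from some monomial of degree \<open>s\<close>, so the coefficients in terms of
  \<open>M\<^sub>J\<close> can be read off. A monomial of degree \<open>s\<close> with repetition set \<open>J\<close> has \<open>s - |J|\<close> distinct
  letters; hence \<open>\<eta>\<^sub>I\<close> is the sum of \<open>(q+1)\<^bsup>s-|J|\<^esup> M\<^sub>J\<close> over \<open>J \<supseteq> I\<close>, and inclusion-exclusion
  inverts this triangular system.
\<close>

section \<open>Sorted words and repetition sets\<close>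

definition repetitions :: "nat multiset \<Rightarrow> nat set" where
  "repetitions m = {j\<in>{1..size m - 1}.
     sorted_list_of_multiset m ! (j - 1) = sorted_list_of_multiset m ! j}"

lemma repetitions_subset: "repetitions m \<subseteq> {1..size m - 1}"
  by (auto simp: repetitions_def)

lemma finite_repetitions [simp]: "finite (repetitions m)"
  by (rule finite_subset[OF repetitions_subset]) simp

lemma length_sorted_list_of_multiset [simp]: "length (sorted_list_of_multiset m) = size m"
  by (metis mset_sorted_list_of_multiset size_mset)

lemma sorted_and_mset_eq_iff: "sorted w \<and> mset w = m \<longleftrightarrow> w = sorted_list_of_multiset m"
  by (metis mset_sorted_list_of_multiset sorted_list_of_multiset_mset sorted_sort sorted_sort_id)

text \<open>A multiset has exactly one sorted arrangement. The condition \<open>P\<close> is left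
  abstract so that both \<open>monom_qsym\<close> and \<open>eta\<close> are covered.\<close>

lemma sum_sorted_words:
  fixes h :: "nat list \<Rightarrow> 'k::comm_monoid_add"
  shows "(\<Sum>w | length w = s \<and> sorted w \<and> P w \<and> mset w = m. h w) =
    (if size m = s \<and> P (sorted_list_of_multiset m) then h (sorted_list_of_multiset m) else 0)"
proof -
  have "{w. length w = s \<and> sorted w \<and> P w \<and> mset w = m} =
      {w. w = sorted_list_of_multiset m \<and> length w = s \<and> P w}"
    using sorted_and_mset_eq_iff by blast
  also have "\<dots> = (if size m = s \<and> P (sorted_list_of_multiset m) then {sorted_list_of_multiset m} else {})"
    by auto
  finally show ?thesis by simp
qed

text \<open>In a sorted word, equal letters at two positions squeeze all letters between them;
  conversely, equalities of neighbours chain together.\<close>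

lemma sorted_nth_eq_iff_repetitions:
  assumes "k \<le> l" "l < size m"
  shows "sorted_list_of_multiset m ! k = sorted_list_of_multiset m ! l \<longleftrightarrow>
    {k<..l} \<subseteq> repetitions m"
proof
  let ?w = "sorted_list_of_multiset m"
  have mono: "?w ! a \<le> ?w ! b" if "a \<le> b" "b < size m" for a b
    using that by (intro sorted_nth_mono) auto
  assume eq: "?w ! k = ?w ! l"
  show "{k<..l} \<subseteq> repetitions m"
  proof
    fix j assume j: "j \<in> {k<..l}"
    then have "?w ! k \<le> ?w ! (j - 1)" "?w ! (j - 1) \<le> ?w ! j" "?w ! j \<le> ?w ! l"
      using assms by (auto intro!: mono)
    then show "j \<in> repetitions m"
      using j assms eq by (auto simp: repetitions_def)
  qed
next
  let ?w = "sorted_list_of_multiset m"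
  assume "{k<..l} \<subseteq> repetitions m"
  with assms(1) show "?w ! k = ?w ! l"
  proof (induction l rule: dec_induct)
    case (step n)
    then have "Suc n \<in> repetitions m" by auto
    then have "?w ! n = ?w ! Suc n" by (auto simp: repetitions_def)
    moreover have "{k<..n} \<subseteq> repetitions m" using step.prems by auto
    ultimately show ?case using step.IH by simp
  qed simp
qed

text \<open>Counting positions from 0, those outside \<open>repetitions m\<close> are the first
  occurrences of the letters. Position 0 always qualifies, since repetitions start at 1.\<close>

lemma card_set_mset_eq: "card (set_mset m) = size m - card (repetitions m)"
proof -
  let ?w = "sorted_list_of_multiset m"
  let ?F = "{..<size m} - repetitions m"
  have "bij_betw ((!) ?w) ?F (set_mset m)"
  proof (rule bij_betw_imageI)
    show "inj_on ((!) ?w) ?F"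
    proof (rule linorder_inj_onI)
      fix k l assume "k < l" "k \<in> ?F" "l \<in> ?F"
      then show "?w ! k \<noteq> ?w ! l"
        using sorted_nth_eq_iff_repetitions[of k l m] by auto
    qed auto
    show "(!) ?w ` ?F = set_mset m"
    proof
      show "(!) ?w ` ?F \<subseteq> set_mset m"
        by (auto simp flip: set_sorted_list_of_multiset)
      show "set_mset m \<subseteq> (!) ?w ` ?F"
      proof
        fix x assume "x \<in> set_mset m"
        then have ex: "\<exists>k<size m. ?w ! k = x"
          by (metis in_set_conv_nth length_sorted_list_of_multiset set_sorted_list_of_multiset)
        \<comment> \<open>The leftmost occurrence of \<open>x\<close>; a repetition there would give
          an earlier one at \<open>k - 1\<close>.\<close>
        define k where "k = (LEAST k. k < size m \<and> ?w ! k = x)"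
        have k: "k < size m" "?w ! k = x"
          using LeastI_ex[OF ex] by (auto simp: k_def)
        have "k \<notin> repetitions m"
        proof
          assume "k \<in> repetitions m"
          then have "k - 1 < size m \<and> ?w ! (k - 1) = x" "k - 1 < k"
            using k by (auto simp: repetitions_def)
          then show False
            using not_less_Least[of "k - 1" "\<lambda>k. k < size m \<and> ?w ! k = x"]
            by (simp add: k_def)
        qed
        then show "x \<in> (!) ?w ` ?F" using k by auto
      qed
    qed
  qed
  then have "card (set_mset m) = card ?F" by (simp add: bij_betw_same_card)
  also have "\<dots> = size m - card (repetitions m)"
    using repetitions_subset[of m] by (subst card_Diff_subset) fastforce+
  finally show ?thesis .
qed

text \<open>The definition tests only indices in \<open>{1..s-1}\<close>, so the range assumption on
  \<open>J\<close> turns those tests into an equality of sets.\<close>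

lemma monom_qsym_coeff:
  assumes "J \<subseteq> {1..s-1}"
  shows "monom_qsym s J m = (if size m = s \<and> repetitions m = J then 1 else 0)"
  unfolding monom_qsym_def sum_sorted_words using assms by (auto simp: repetitions_def)

lemma eta_coeff:
  assumes "I \<subseteq> {1..s-1}"
  shows "eta q s I m =
    (if size m = s \<and> I \<subseteq> repetitions m then (q + 1) ^ (s - card (repetitions m)) else 0)"
  unfolding eta_def sum_sorted_words
  using assms by (auto simp: repetitions_def card_set_mset_eq)

lemma sum_fun_apply: "(\<Sum>a\<in>A. g a) x = (\<Sum>a\<in>A. g a x)"
  by (induction A rule: infinite_finite_induct) auto

lemma sum_ps_scale_apply: "(\<Sum>a\<in>A. c a *\<^sub>s g a) m = (\<Sum>a\<in>A. c a * g a m)"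
  by (simp add: sum_fun_apply ps_scale_def)

section \<open>Inclusion-exclusion and the expansion of \<open>monom_qsym\<close>\<close>

text \<open>Removing \<open>J\<close> from each \<open>I\<close> leaves a signed sum over all
  subsets of \<open>K - J\<close>, which is the expanded product of the factors
  \<open>(- 1) + 1\<close>.\<close>

lemma alternating_sum_interval:
  fixes J K :: "'a set"
  assumes "finite K" "J \<subseteq> K"
  shows "(\<Sum>I | J \<subseteq> I \<and> I \<subseteq> K. (- 1) ^ card (I - J)) = (if J = K then 1 else (0::'k::comm_ring_1))"
proof -
  have "(\<Sum>I | J \<subseteq> I \<and> I \<subseteq> K. (- 1) ^ card (I - J)) = (\<Sum>I\<in>Pow (K - J). (- 1) ^ card I :: 'k)"
    using assms by (intro sum.reindex_bij_witness[of _ "\<lambda>I. I \<union> J" "\<lambda>I. I - J"])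
      (auto intro!: arg_cong[of _ _ card] arg_cong2[of _ _ _ _ "(^)"])
  also have "\<dots> = (\<Prod>x\<in>K - J. (- 1) + 1)"
    using assms by (subst prod_add) (auto simp: Pow_def)
  also have "\<dots> = (if J = K then 1 else 0)"
    using assms by (auto simp: power_0_left card_eq_0_iff)
  finally show ?thesis .
qed

lemma monom_qsym_expansion:
  fixes q :: "'k::comm_ring_1"
  assumes "J \<subseteq> {1..s-1}"
  shows "(q + 1) ^ (s - card J) *\<^sub>s monom_qsym s J =
    (\<Sum>I | J \<subseteq> I \<and> I \<subseteq> {1..s-1}. (- 1) ^ card (I - J) *\<^sub>s eta q s I)"
proof
  fix m
  let ?A = "{I. J \<subseteq> I \<and> I \<subseteq> {1..s-1}}"
  let ?c = "(q + 1) ^ (s - card (repetitions m))"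
  have fin: "finite ?A" by (rule finite_subset[of _ "Pow {1..s-1}"]) auto
  have "(\<Sum>I\<in>?A. (- 1) ^ card (I - J) *\<^sub>s eta q s I) m =
      (\<Sum>I\<in>?A. (- 1) ^ card (I - J) * eta q s I m)"
    by (rule sum_ps_scale_apply)
  also have "\<dots> = (q + 1) ^ (s - card J) * monom_qsym s J m"
  proof (cases "size m = s \<and> J \<subseteq> repetitions m")
    case True
    \<comment> \<open>Only sets \<open>I\<close> inside \<open>repetitions m\<close> have a nonzero
      coefficient at \<open>m\<close>, and the factor \<open>?c\<close> does not depend on
      \<open>I\<close>.\<close>
    have "(\<Sum>I\<in>?A. (- 1) ^ card (I - J) * eta q s I m) =
        (\<Sum>I | J \<subseteq> I \<and> I \<subseteq> repetitions m. (- 1) ^ card (I - J) * ?c)"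
      using True fin repetitions_subset[of m]
      by (intro sum.mono_neutral_cong_right) (auto simp: eta_coeff)
    also have "\<dots> = (if J = repetitions m then 1 else 0) * ?c"
      using True by (simp add: alternating_sum_interval flip: sum_distrib_right)
    finally show ?thesis
      using True assms by (auto simp: monom_qsym_coeff)
  next
    case False
    then have "(\<Sum>I\<in>?A. (- 1) ^ card (I - J) * eta q s I m) = 0"
      by (intro sum.neutral) (auto simp: eta_coeff)
    with False assms show ?thesis by (auto simp: monom_qsym_coeff)
  qed
  finally show "((q + 1) ^ (s - card J) *\<^sub>s monom_qsym s J) m =
      (\<Sum>I\<in>?A. (- 1) ^ card (I - J) *\<^sub>s eta q s I) m"
    by (simp add: ps_scale_def)
qed

section \<open>Packed monomials as representatives\<close>

text \<open>The index of the \<open>k\<close>-th letter (from 0) in the least monomial with repetition set \<open>J\<close>.\<close>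

definition packed_letter :: "nat set \<Rightarrow> nat \<Rightarrow> nat" where
  "packed_letter J k = card ({1..k} - J)"

definition packed :: "nat \<Rightarrow> nat set \<Rightarrow> nat multiset" where
  "packed s J = mset (map (packed_letter J) [0..<s])"

lemma size_packed [simp]: "size (packed s J) = s"
  by (simp add: packed_def)

lemma mono_packed_letter: "k \<le> l \<Longrightarrow> packed_letter J k \<le> packed_letter J l"
  unfolding packed_letter_def by (intro card_mono) auto

text \<open>Both sides count nested finite sets, so the counts agree only if the sets do. This
  matches \<open>sorted_nth_eq_iff_repetitions\<close>: a monomial and its packed form have the same
  pattern of equalities.\<close>

lemma packed_letter_eq_iff:
  assumes "k \<le> l"
  shows "packed_letter J k = packed_letter J l \<longleftrightarrow> {k<..l} \<subseteq> J"
proof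
  assume "packed_letter J k = packed_letter J l"
  then have "{1..k} - J = {1..l} - J"
    unfolding packed_letter_def using assms by (intro card_subset_eq) auto
  moreover have "x \<in> {1..l}" "x \<notin> {1..k}" if "x \<in> {k<..l}" for x
    using that by auto
  ultimately show "{k<..l} \<subseteq> J" by blast
next
  assume "{k<..l} \<subseteq> J"
  moreover have "x \<in> {k<..l}" if "x \<in> {1..l}" "x \<notin> {1..k}" for x
    using that by auto
  moreover have "{1..k} \<subseteq> {1..l}" using assms by auto
  ultimately have "{1..k} - J = {1..l} - J" by blast
  then show "packed_letter J k = packed_letter J l" by (simp add: packed_letter_def)
qed

text \<open>The letters start at 0 and grow by at most 1 per step, so none is skipped. The packed
  letters thus form an initial segment, as the definition of \<open>QSym\<close> requires.\<close>

lemma packed_letter_surj: "j \<le> packed_letter J k \<Longrightarrow> \<exists>l\<le>k. packed_letter J l = j"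
proof (induction k)
  case (Suc k)
  have "packed_letter J (Suc k) \<le> Suc (packed_letter J k)"
    unfolding packed_letter_def
    by (simp add: atLeastAtMostSuc_conv insert_Diff_if card_insert_if)
  then consider "j \<le> packed_letter J k" | "packed_letter J (Suc k) = j"
    using Suc.prems by linarith
  then show ?case
  proof cases
    case 1
    then show ?thesis using Suc.IH le_SucI by blast
  qed blast
qed (auto simp: packed_letter_def)

lemma sorted_list_of_packed: "sorted_list_of_multiset (packed s J) = map (packed_letter J) [0..<s]"
proof -
  have "sorted (map (packed_letter J) [0..<s])"
    by (auto simp: sorted_iff_nth_mono intro: mono_packed_letter)
  then show ?thesis
    using sorted_and_mset_eq_iff[of "map (packed_letter J) [0..<s]" "packed s J"]
    by (simp add: packed_def)
qed

lemma repetitions_packed: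
  assumes "J \<subseteq> {1..s-1}"
  shows "repetitions (packed s J) = J"
proof -
  have "packed_letter J (j - 1) = packed_letter J j \<longleftrightarrow> j \<in> J" if "j \<in> {1..s-1}" for j
  proof -
    have "{j - 1<..j} = {j}" using that by auto
    then show ?thesis using packed_letter_eq_iff[of "j - 1" j J] by simp
  qed
  moreover have "repetitions (packed s J) =
      {j\<in>{1..s-1}. packed_letter J (j - 1) = packed_letter J j}"
    by (auto simp: repetitions_def sorted_list_of_packed)
  ultimately show ?thesis using assms by blast
qed

section \<open>Quasisymmetry as invariance under increasing relabelling\<close>

lemma sum_replicate_eq_image_mset:
  "(\<Sum>j<p. replicate_mset (k j) (i j)) = image_mset i (\<Sum>j<(p::nat). replicate_mset (k j) j)"
  by (induction p) auto

lemma sum_replicate_count: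
  assumes "set_mset m \<subseteq> {..<(p::nat)}"
  shows "(\<Sum>j<p. replicate_mset (count m j) j) = m"
proof (rule multiset_eqI)
  fix x
  have "count (\<Sum>j<p. replicate_mset (count m j) j) x =
      (\<Sum>j<p. if j = x then count m x else 0)"
    by (auto simp: count_sum intro!: sum.cong)
  also have "\<dots> = count m x"
    using assms by (auto simp: sum.delta count_eq_zero_iff)
  finally show "count (\<Sum>j<p. replicate_mset (count m j) j) x = count m x" .
qed

text \<open>An increasing relabelling carries the sorted word to the sorted word and keeps distinct
  letters distinct.\<close>

lemma repetitions_image_mset:
  assumes "strict_mono_on (set_mset m) i"
  shows "repetitions (image_mset i m) = repetitions m"
proof -
  let ?w = "sorted_list_of_multiset m"
  have mono: "i x \<le> i y" if "x \<in># m" "y \<in># m" "x \<le> y" for x y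
    using that assms by (metis le_less strict_mono_onD)
  have eq: "i x = i y \<longleftrightarrow> x = y" if "x \<in># m" "y \<in># m" for x y
    using that assms by (metis strict_mono_on_imp_inj_on inj_on_eq_iff)
  have mem: "?w ! k \<in># m" if "k < size m" for k
    using that by (metis length_sorted_list_of_multiset nth_mem set_sorted_list_of_multiset)
  have "sorted (map i ?w)"
    unfolding sorted_iff_nth_mono by (auto intro!: mono mem sorted_nth_mono)
  then have "sorted_list_of_multiset (image_mset i m) = map i ?w"
    using sorted_and_mset_eq_iff[of "map i ?w" "image_mset i m"] by simp
  then show ?thesis
    by (auto simp: repetitions_def mem eq)
qed

text \<open>Every monomial arises from its packed form by a strictly increasing relabelling of the
  letters, which leaves the coefficients of \<open>f\<close> unchanged.\<close>

lemma QSym_coeff_packed: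
  assumes "f \<in> QSym"
  shows "f m = f (packed (size m) (repetitions m))"
proof (cases "size m = 0")
  case False
  let ?w = "sorted_list_of_multiset m"
  define s where "s = size m"
  define c where "c = packed_letter (repetitions m)"
  define C where "C = packed s (repetitions m)"
  \<comment> \<open>The number of distinct letters: one more than the largest packed letter, which
    stands at the last position \<open>s - 1\<close>.\<close>
  define p where "p = Suc (c (s - 1))"
  \<comment> \<open>The relabelling sends a packed letter to the letter of \<open>m\<close> at the
    same position. The choice of position is immaterial by \<open>c_eq\<close>; the least one is
    taken.\<close>
  define i where "i j = ?w ! (LEAST k. c k = j)" for j
  have c_eq: "c k = c l \<longleftrightarrow> ?w ! k = ?w ! l" if "k \<le> l" "l < s" for k l
    using that sorted_nth_eq_iff_repetitions[of k l m] packed_letter_eq_iff[of k l]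
    by (simp add: c_def s_def)
  have i_c: "i (c k) = ?w ! k" if "k < s" for k
  proof -
    have "(LEAST l. c l = c k) \<le> k" "c (LEAST l. c l = c k) = c k"
      by (auto intro: Least_le LeastI)
    then show ?thesis unfolding i_def using c_eq that by blast
  qed
  have "strict_mono_on {..<p} i"
  proof (rule strict_mono_onI)
    fix a b assume ab: "a \<in> {..<p}" "b \<in> {..<p}" "a < b"
    \<comment> \<open>Every letter below \<open>p\<close> occurs in the packed word, so monotonicity
      of \<open>i\<close> reduces to a comparison of positions.\<close>
    have "\<exists>k\<le>s - 1. c k = j" if "j \<in> {..<p}" for j
      using that packed_letter_surj[of j "repetitions m" "s - 1"]
      by (simp add: p_def c_def less_Suc_eq_le)
    with ab obtain k l where kl: "k \<le> s - 1" "c k = a" "l \<le> s - 1" "c l = b"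
      by meson
    have less: "k < s" "l < s" using kl(1,3) False unfolding s_def by linarith+
    have "k < l"
      using kl ab(3) mono_packed_letter[of l k "repetitions m"] by (cases "k < l") (auto simp: c_def)
    then have "?w ! k \<le> ?w ! l" "?w ! k \<noteq> ?w ! l"
      using less kl ab(3) c_eq[of k l] by (auto intro!: sorted_nth_mono simp: s_def)
    then show "i a < i b" using i_c less kl by fastforce
  qed
  then have f: "f (\<Sum>j<p. replicate_mset (count C j) (i j)) =
      f (\<Sum>j<p. replicate_mset (count C j) j)"
    using assms unfolding QSym_def by blast
  have "set_mset C \<subseteq> {..<p}"
    by (auto simp: C_def packed_def p_def c_def less_Suc_eq_le intro!: mono_packed_letter)
  then have C: "(\<Sum>j<p. replicate_mset (count C j) j) = C"
    by (rule sum_replicate_count)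
  have "map i (map c [0..<s]) = ?w"
    by (rule nth_equalityI) (auto simp: i_c s_def)
  then have "image_mset i C = m"
    unfolding C_def packed_def c_def by (metis mset_map mset_sorted_list_of_multiset)
  then have "(\<Sum>j<p. replicate_mset (count C j) (i j)) = m"
    using sum_replicate_eq_image_mset[of "count C" i p] C by simp
  with f C show ?thesis by (simp add: C_def s_def)
qed (simp add: packed_def)

text \<open>By \<open>eta_coeff\<close> the coefficients depend only on degree and repetition set,
  and relabelling preserves both.\<close>

lemma eta_in_QSym:
  assumes "I \<subseteq> {1..s-1}"
  shows "eta q s I \<in> QSym"
proof -
  have "bounded_degree (eta q s I)"
    unfolding bounded_degree_def using assms by (auto simp: eta_coeff intro!: exI[of _ s])
  moreover have "eta q s I (\<Sum>j<p. replicate_mset (k j) (i j)) =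
      eta q s I (\<Sum>j<p. replicate_mset (k j) j)"
    if "strict_mono_on {..<p} i" for p i and k :: "nat \<Rightarrow> nat"
  proof -
    have "set_mset (\<Sum>j<p. replicate_mset (k j) j) \<subseteq> {..<p}"
      by (auto simp: set_mset_sum split: if_splits)
    then have "strict_mono_on (set_mset (\<Sum>j<p. replicate_mset (k j) j)) i"
      using that by (rule monotone_on_subset[rotated])
    then show ?thesis
      unfolding sum_replicate_eq_image_mset[of k i]
      using assms by (simp add: eta_coeff repetitions_image_mset)
  qed
  ultimately show ?thesis by (simp add: QSym_def)
qed

lemma subspace_QSym: "power_series.subspace QSym"
proof (rule power_series.subspaceI)
  show "0 \<in> (QSym :: 'a power_series set)"
    by (simp add: QSym_def bounded_degree_def)
next
  fix f g :: "'a power_series" assume fg: "f \<in> QSym" "g \<in> QSym"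
  then obtain d e where "\<forall>m. f m \<noteq> 0 \<longrightarrow> size m \<le> d" "\<forall>m. g m \<noteq> 0 \<longrightarrow> size m \<le> e"
    by (auto simp: QSym_def bounded_degree_def)
  then have "\<forall>m. (f + g) m \<noteq> 0 \<longrightarrow> size m \<le> max d e"
    by (metis add_0 le_max_iff_disj plus_fun_apply)
  then show "f + g \<in> QSym"
    using fg by (auto simp: QSym_def bounded_degree_def)
next
  fix c :: 'a and f :: "'a power_series" assume "f \<in> QSym"
  then show "c *\<^sub>s f \<in> QSym"
    unfolding QSym_def bounded_degree_def ps_scale_def by (auto, metis mult_zero_right)
qed

section \<open>Generation of \<open>QSym\<close>\<close>

text \<open>At a monomial \<open>m\<close> only the index \<open>(size m, repetitions m)\<close>
  contributes. The degree bound makes the sum finite.\<close>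

lemma QSym_eq_sum_monom_qsym:
  assumes "f \<in> QSym" and d: "\<And>m. f m \<noteq> 0 \<Longrightarrow> size m \<le> d"
  shows "f = (\<Sum>(s, J)\<in>(SIGMA s:{..d}. Pow {1..s-1}). f (packed s J) *\<^sub>s monom_qsym s J)"
proof
  fix m
  let ?A = "SIGMA s:{..d}. Pow {1..s-1}"
  have "(\<Sum>(s, J)\<in>?A. f (packed s J) *\<^sub>s monom_qsym s J) m =
      (\<Sum>a\<in>?A. if a = (size m, repetitions m) then f m else 0)"
    unfolding sum_fun_apply using QSym_coeff_packed[OF assms(1), of m]
    by (intro sum.cong) (auto simp: ps_scale_def monom_qsym_coeff split: if_splits)
  also have "\<dots> = f m"
    using d[of m] repetitions_subset[of m] by (auto simp: sum.delta)
  finally show "f m = (\<Sum>(s, J)\<in>?A. f (packed s J) *\<^sub>s monom_qsym s J) m" by simp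
qed

text \<open>Since \<open>q + 1\<close> is a unit, the power of \<open>q + 1\<close> in
  \<open>monom_qsym_expansion\<close> can be divided out.\<close>

lemma monom_qsym_in_span_eta:
  fixes q :: "'k::comm_ring_1"
  assumes "(q + 1) dvd 1" "J \<subseteq> {1..s-1}"
  shows "monom_qsym s J \<in> power_series.span ((\<lambda>(s, I). eta q s I) ` (SIGMA s:UNIV. Pow {1..s-1}))"
    (is "_ \<in> ?S")
proof -
  obtain r where r: "(q + 1) * r = 1" using assms(1) by (metis dvdE)
  have "(q + 1) ^ (s - card J) *\<^sub>s monom_qsym s J \<in> ?S"
    unfolding monom_qsym_expansion[OF assms(2)]
    by (intro power_series.span_sum power_series.span_scale power_series.span_base) force
  then have "r ^ (s - card J) *\<^sub>s (q + 1) ^ (s - card J) *\<^sub>s monom_qsym s J \<in> ?S"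
    by (rule power_series.span_scale)
  moreover have "r ^ (s - card J) * (q + 1) ^ (s - card J) = 1"
    using r by (simp add: mult.commute flip: power_mult_distrib)
  ultimately show ?thesis by simp
qed

lemma span_eta:
  fixes q :: "'k::comm_ring_1"
  assumes "(q + 1) dvd 1"
  shows "power_series.span ((\<lambda>(s, I). eta q s I) ` (SIGMA s:UNIV. Pow {1..s-1})) = QSym"
proof (rule antisym)
  show "power_series.span ((\<lambda>(s, I). eta q s I) ` (SIGMA s:UNIV. Pow {1..s-1})) \<subseteq> QSym"
    by (intro power_series.span_minimal subspace_QSym)
      (auto intro!: eta_in_QSym simp del: One_nat_def)
  show "QSym \<subseteq> power_series.span ((\<lambda>(s, I). eta q s I) ` (SIGMA s:UNIV. Pow {1..s-1}))"
  proof
    fix f :: "'k power_series" assume f: "f \<in> QSym"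
    then obtain d where d: "\<And>m. f m \<noteq> 0 \<Longrightarrow> size m \<le> d"
      by (auto simp: QSym_def bounded_degree_def)
    have "f (packed s J) *\<^sub>s monom_qsym s J \<in>
        power_series.span ((\<lambda>(s, I). eta q s I) ` (SIGMA s:UNIV. Pow {1..s-1}))"
      if "J \<subseteq> {1..s-1}" for s J
      by (intro power_series.span_scale monom_qsym_in_span_eta assms that)
    then have "(\<Sum>(s, J)\<in>(SIGMA s:{..d}. Pow {1..s-1}). f (packed s J) *\<^sub>s monom_qsym s J) \<in>
        power_series.span ((\<lambda>(s, I). eta q s I) ` (SIGMA s:UNIV. Pow {1..s-1}))"
      by (intro power_series.span_sum) (auto simp del: One_nat_def)
    then show "f \<in> power_series.span ((\<lambda>(s, I). eta q s I) ` (SIGMA s:UNIV. Pow {1..s-1}))"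
      by (subst QSym_eq_sum_monom_qsym[OF f d])
  qed
qed

section \<open>Linear independence\<close>

text \<open>Triangularity with respect to inclusion of sets. The relation is indexed by pairs rather
  than by series, so that injectivity follows from it as well.\<close>

lemma eta_linearly_independent:
  fixes q :: "'k::comm_ring_1"
  assumes q: "(q + 1) dvd 1" and T: "finite T" "T \<subseteq> (SIGMA s:UNIV. Pow {1..s-1})"
    and zero: "(\<Sum>a\<in>T. u a *\<^sub>s (case a of (s, I) \<Rightarrow> eta q s I)) = 0"
    and "a \<in> T"
  shows "u a = 0"
proof (rule ccontr)
  assume "u a \<noteq> 0"
  with \<open>a \<in> T\<close> obtain b where b: "b \<in> T \<and> u b \<noteq> 0"
    and min: "\<And>b'. b' \<in> T \<and> u b' \<noteq> 0 \<Longrightarrow> card (snd b) \<le> card (snd b')"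
    using ex_has_least_nat[of "\<lambda>b. b \<in> T \<and> u b \<noteq> 0" a "\<lambda>b. card (snd b)"] by blast
  obtain s I where sI: "b = (s, I)" by (cases b)
  have I: "I \<subseteq> {1..s-1}" using b T(2) sI by auto
  then have "finite I" by (rule finite_subset) simp
  \<comment> \<open>At \<open>packed s I\<close> only indices \<open>(s, K)\<close> with
    \<open>K \<subseteq> I\<close> can contribute, and proper subsets \<open>K\<close> have zero
    coefficient by minimality of \<open>card I\<close>. What remains is \<open>u b\<close> times a
    unit.\<close>
  have "0 = (\<Sum>a\<in>T. u a *\<^sub>s (case a of (s, I) \<Rightarrow> eta q s I)) (packed s I)"
    by (simp add: zero)
  also have "\<dots> = (\<Sum>a\<in>T. if a = b then u b * (q + 1) ^ (s - card I) else 0)"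
    unfolding sum_ps_scale_apply
  proof (rule sum.cong)
    fix a assume a: "a \<in> T"
    obtain t K where tK: "a = (t, K)" by (cases a)
    have K: "K \<subseteq> {1..t-1}" using a T(2) tK by auto
    have "u a = 0" if "K \<subset> I"
      using psubset_card_mono[OF \<open>finite I\<close> that] min[of a] a by (auto simp: tK sI)
    then show "u a * (case a of (s, I) \<Rightarrow> eta q s I) (packed s I) =
        (if a = b then u b * (q + 1) ^ (s - card I) else 0)"
      using repetitions_packed[OF I] K by (cases "K = I") (auto simp: tK sI eta_coeff psubset_eq)
  qed simp
  also have "\<dots> = u b * (q + 1) ^ (s - card I)"
    using T(1) b by simp
  finally have "u b * (q + 1) ^ (s - card I) = 0" by simp
  moreover obtain r where "(q + 1) ^ (s - card I) * r = 1"
    using q by (metis dvdE is_unit_power_iff dvd_power_same power_one)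
  ultimately have "u b = 0" by (metis mult.assoc mult_1_right mult_zero_left)
  with b show False by simp
qed

text \<open>Two distinct indices with the same series would satisfy a relation with coefficients 1
  and -1, forcing 1 = 0.\<close>

lemma inj_on_eta:
  fixes q :: "'k::comm_ring_1"
  assumes "(q + 1) dvd 1"
  shows "inj_on (\<lambda>(s, I). eta q s I) (SIGMA s:UNIV. Pow {1..s-1})"
proof (rule inj_onI, rule ccontr)
  let ?e = "\<lambda>(s, I). eta q s I"
  fix a b assume ab: "a \<in> (SIGMA s:UNIV. Pow {1..s-1})" "b \<in> (SIGMA s:UNIV. Pow {1..s-1})"
    "?e a = ?e b" "a \<noteq> b"
  let ?u = "\<lambda>x. if x = a then 1 else (- 1 :: 'k)"
  have "(\<Sum>x\<in>{a, b}. ?u x *\<^sub>s ?e x) = 0"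
    using ab(3,4) by (auto simp: ps_scale_def fun_eq_iff)
  then have "?u a = 0"
    using ab by (intro eta_linearly_independent[OF assms, of "{a, b}" ?u a]) auto
  then show False by simp
qed

lemma independent_eta:
  fixes q :: "'k::comm_ring_1"
  assumes "(q + 1) dvd 1"
  shows "power_series.independent ((\<lambda>(s, I). eta q s I) ` (SIGMA s:UNIV. Pow {1..s-1}))"
    (is "power_series.independent (?e ` ?A)")
proof
  assume "power_series.dependent (?e ` ?A)"
  then obtain t u v where t: "finite t" "t \<subseteq> ?e ` ?A" "(\<Sum>v\<in>t. u v *\<^sub>s v) = 0"
    and v: "v \<in> t" "u v \<noteq> 0"
    unfolding power_series.dependent_explicit by blast
  \<comment> \<open>Independence in the library concerns sets of vectors; the relation is pulled
    back to indices, where injectivity prevents terms from merging.\<close>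
  from finite_subset_image[OF t(1,2)] obtain T where T: "T \<subseteq> ?A" "finite T" "t = ?e ` T"
    by blast
  have inj: "inj_on ?e T" using inj_on_eta[OF assms] T(1) by (rule inj_on_subset)
  have "(\<Sum>a\<in>T. u (?e a) *\<^sub>s ?e a) = 0"
    using t(3) unfolding T(3) sum.reindex[OF inj] by (simp add: o_def)
  then have "u (?e a) = 0" if "a \<in> T" for a
    by (rule eta_linearly_independent[OF assms T(2,1) _ that])
  with v T(3) show False by auto
qed

theorem theorem3p7:
  fixes q :: "'k::comm_ring_1"
  assumes "(q + 1) dvd 1"
  shows "is_basis_of (SIGMA s:UNIV. Pow {1..s-1}) (\<lambda>(s, I). eta q s I) QSym \<and>
    (\<forall>s J. J \<subseteq> {1..s-1} \<longrightarrow>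
      (q + 1) ^ (s - card J) *\<^sub>s monom_qsym s J =
        (\<Sum>I | J \<subseteq> I \<and> I \<subseteq> {1..s-1}. (- 1) ^ card (I - J) *\<^sub>s eta q s I))"
  unfolding is_basis_of_def
  using inj_on_eta[OF assms] independent_eta[OF assms] span_eta[OF assms] monom_qsym_expansion
  by blast

end
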